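(* Let $\gamma>0$. The tight windows at critical density $a=b=1$ canonically associated to the Gaussian $g_{1,\gamma}$ and to the hyperbolic secant $g_{2,\gamma}$ coincide: $g^t_{1,\gamma}=g^t_{2,\gamma}$, where for $k=1,2$ $$g^t_{k,\gamma}(t)=\int_0^1\frac{(Zg_{k,\gamma})(t,\nu)}{|(Zg_{k,\gamma})(t,\nu)|}\,d\nu,\qquad t\in\mathbb{R}.$$
   Context: For $\gamma>0$ and $t\in\mathbb{R}$, $g_{1,\gamma}(t)=(2\gamma)^{1/4}e^{-\pi\gamma t^2}$ and $g_{2,\gamma}(t)=\left(\frac{\pi\gamma}{2}\right)^{1/2}\frac{1}{\cosh\pi\gamma t}$. The Zak transform of a function $g$ is $(Zg)(t,\nu)=\sum_{l=-\infty}^{\infty}g(t-l)e^{2\pi i l\nu}$, $t,\nu\in\mathbb{R}$. The integrands are defined wherever the Zak transforms do not vanish, i.e. almost everywhere. *)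

theory Defs
  imports "HOL-Analysis.Analysis"
begin

definition gaussian_window :: "real \<Rightarrow> real \<Rightarrow> complex" where
  "gaussian_window \<gamma> t = of_real ((2 * \<gamma>) powr (1/4) * exp (- pi * \<gamma> * t\<^sup>2))"

definition sech_window :: "real \<Rightarrow> real \<Rightarrow> complex" where
  "sech_window \<gamma> t = of_real ((pi * \<gamma> / 2) powr (1/2) * (1 / cosh (pi * \<gamma> * t)))"

text \<open>
  The bilateral series is read as an unconditional sum over the integers; for the two
  windows above it converges absolutely.
\<close>

definition zak :: "(real \<Rightarrow> complex) \<Rightarrow> real \<Rightarrow> real \<Rightarrow> complex" where
  "zak g t \<nu> = (\<Sum>\<^sub>\<infinity>l\<in>(UNIV :: int set). g (t - of_int l) * exp (2 * of_real pi * \<i> * of_int l * of_real \<nu>))"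

text \<open>
  Lebesgue integral over the unit interval. Where the Zak transform vanishes the quotient
  is \<open>0\<close> by the convention \<open>x / 0 = 0\<close>; for the two windows above and each \<open>t\<close> this
  concerns only a null set of \<open>\<nu>\<close>, so the value of the integral is unaffected.
\<close>

definition tight_window :: "(real \<Rightarrow> complex) \<Rightarrow> real \<Rightarrow> complex" where
  "tight_window g t = (LBINT \<nu>:{0..1}. zak g t \<nu> / of_real (cmod (zak g t \<nu>)))"

end

theory Submission
  imports Defs
begin

text \<open>
  Write \<open>a = \<pi> \<gamma>\<close>, let \<open>G\<close> and \<open>F\<close> be the Zak transforms of \<open>1 / cosh (a t)\<close> and \<open>exp (- a t\<^sup>2)\<close>,
  and let \<open>\<theta> \<nu> = \<Sum> (-1)\<^sup>k exp (- a k\<^sup>2) exp (2 \<pi> i k \<nu>)\<close>. By convolution of Fourier series, \<open>\<theta> \<nu> G(t, \<nu>)\<close> has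
  Fourier coefficients \<open>h (t - n)\<close>, where \<open>h s = \<Sum> (-1)\<^sup>k exp (- a k\<^sup>2) / cosh (a (s + k))\<close>.
  The function \<open>P t = h t exp (a t\<^sup>2)\<close> is 1-periodic, because
  \<open>(1 + exp (2 x)) / cosh x = 2 exp x\<close> reduces \<open>P t - P (t + 1)\<close> to a sum that is
  antisymmetric under \<open>k \<mapsto> 1 - k\<close>. Hence \<open>\<theta> \<nu> G(t, \<nu>) = P t F(t, \<nu>)\<close>, and it remains to see that
  \<open>\<theta>\<close> and \<open>P\<close> are positive. For \<open>P\<close> put \<open>\<nu> = 0\<close>, where \<open>G\<close> and \<open>F\<close> are
  positive. For \<open>\<theta>\<close>, Landen's identity \<open>\<theta>\<^sub>a x \<theta>\<^sub>a (x + 1/2) = \<theta>\<^bsub>2a\<^esub> 0 \<theta>\<^bsub>2a\<^esub> (2 x)\<close> shows that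
  \<open>\<theta>\<^sub>a\<close> has no real zero if \<open>\<theta>\<^bsub>2a\<^esub>\<close> is positive, and for large \<open>a\<close> positivity is clear.
\<close>

section \<open>Sums over the integers\<close>

text \<open>The involution \<open>i\<close> carries the sum into its own negative. Three
  cancellations rest on this: the sines in the theta series, the pairs of odd sum in Landen's
  identity, and the periodicity of \<open>zak_ratio\<close>.\<close>

lemma infsum_antisymmetric:
  fixes f :: "'a \<Rightarrow> 'b :: real_normed_vector"
  assumes "\<And>x. x \<in> A \<Longrightarrow> i x \<in> A" "\<And>x. x \<in> A \<Longrightarrow> i (i x) = x"
    and "\<And>x. x \<in> A \<Longrightarrow> f (i x) = - f x"
  shows "infsum f A = 0"
proof -
  have "infsum f A = infsum (\<lambda>x. - f x) A"
    by (rule infsum_reindex_bij_witness[of A i i]) (use assms in auto)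
  also have "\<dots> = - infsum f A"
    by (rule infsum_uminus)
  finally have "infsum f A + infsum f A = 0"
    by (simp add: eq_neg_iff_add_eq_0)
  then have "2 *\<^sub>R infsum f A = 0"
    by (simp add: scaleR_2)
  then show ?thesis by simp
qed

lemma summable_on_times_complex:
  fixes f :: "'a \<Rightarrow> complex" and g :: "'b \<Rightarrow> complex"
  assumes "f summable_on A" "g summable_on B"
  shows "(\<lambda>(x, y). f x * g y) summable_on A \<times> B"
proof -
  have f: "(\<lambda>x. norm (f x)) summable_on A" and g: "(\<lambda>x. norm (g x)) summable_on B"
    using assms by (simp_all add: summable_on_iff_abs_summable_on_complex)
  have "(\<lambda>(x, y). norm (f x) * norm (g y)) summable_on A \<times> B"
  proof (rule summable_on_SigmaI)
    show "((\<lambda>y. case (x, y) of (x, y) \<Rightarrow> norm (f x) * norm (g y)) has_sum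
            norm (f x) * infsum (\<lambda>y. norm (g y)) B) B" for x
      using has_sum_cmult_right[OF has_sum_infsum[OF g], of "norm (f x)"] by simp
    show "(\<lambda>x. norm (f x) * infsum (\<lambda>y. norm (g y)) B) summable_on A"
      by (rule summable_on_cmult_left[OF f])
  qed auto
  then have "(\<lambda>z. norm (case z of (x, y) \<Rightarrow> f x * g y)) summable_on A \<times> B"
    by (simp add: case_prod_unfold norm_mult)
  then show ?thesis
    by (rule abs_summable_summable)
qed

lemma infsum_times_complex:
  fixes f :: "'a \<Rightarrow> complex" and g :: "'b \<Rightarrow> complex"
  assumes "f summable_on A" "g summable_on B"
  shows "infsum (\<lambda>(x, y). f x * g y) (A \<times> B) = infsum f A * infsum g B"
proof -
  have "infsum (\<lambda>(x, y). f x * g y) (A \<times> B) = (\<Sum>\<^sub>\<infinity>x\<in>A. \<Sum>\<^sub>\<infinity>y\<in>B. f x * g y)"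
    using infsum_Sigma_banach[OF summable_on_times_complex[OF assms]] by simp
  also have "\<dots> = (\<Sum>\<^sub>\<infinity>x\<in>A. f x * infsum g B)"
    by (simp add: infsum_cmult_right')
  also have "\<dots> = infsum f A * infsum g B"
    by (rule infsum_cmult_left')
  finally show ?thesis .
qed

text \<open>Absolute convergence over all pairs permits summation along the antidiagonals
  \<open>x + y = n\<close>; this is how two Fourier series are multiplied.\<close>

lemma infsum_convolution_int:
  fixes f g :: "int \<Rightarrow> complex"
  assumes "f summable_on UNIV" "g summable_on UNIV"
  shows "infsum f UNIV * infsum g UNIV = (\<Sum>\<^sub>\<infinity>n. \<Sum>\<^sub>\<infinity>k. f k * g (n - k))"
proof -
  let ?F = "\<lambda>(x, y). f x * g y" and ?H = "\<lambda>(n, k). f k * g (n - k)"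
  have reindex:
    "(?F has_sum S) UNIV \<longleftrightarrow> (?H has_sum S) UNIV" for S
    by (rule has_sum_reindex_bij_witness[of _ "\<lambda>(n, k). (k, n - k)" "\<lambda>(x, y). (x + y, x)"]) auto
  have "(?F has_sum infsum f UNIV * infsum g UNIV) UNIV"
    using has_sum_infsum[OF summable_on_times_complex[OF assms]] infsum_times_complex[OF assms]
    by simp
  then have H: "(?H has_sum infsum f UNIV * infsum g UNIV) (UNIV \<times> UNIV)"
    by (simp add: reindex)
  then have "infsum f UNIV * infsum g UNIV = infsum ?H (UNIV \<times> UNIV)"
    by (simp add: infsumI)
  also have "\<dots> = (\<Sum>\<^sub>\<infinity>n. \<Sum>\<^sub>\<infinity>k. f k * g (n - k))"
    using infsum_Sigma_banach[OF has_sum_imp_summable[OF H]] by simp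
  finally show ?thesis .
qed

lemma infsum_pos_real:
  fixes f :: "'a \<Rightarrow> real"
  assumes "f summable_on A" "\<And>x. x \<in> A \<Longrightarrow> f x > 0" "A \<noteq> {}"
  shows "infsum f A > 0"
proof -
  from assms obtain x where x: "x \<in> A" by auto
  have "sum f {x} \<le> infsum f A"
    by (rule finite_sum_le_infsum) (use assms x in \<open>auto intro: less_imp_le\<close>)
  with assms(2)[OF x] show ?thesis by simp
qed

section \<open>Comparison with the two-sided geometric series\<close>

text \<open>One geometric series for each sign. The exact value without the term at 0 later bounds
  the tail of the theta series.\<close>

lemma has_sum_geometric_int_nonzero:
  fixes a :: real
  assumes "a > 0"
  shows "((\<lambda>k::int. exp (- a * \<bar>of_int k\<bar>)) has_sum (2 * (exp (- a) / (1 - exp (- a))))) (- {0})"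
proof -
  let ?f = "\<lambda>k::int. exp (- a * \<bar>of_int k\<bar>)" and ?s = "exp (- a) / (1 - exp (- a))"
  have "((\<lambda>n. exp (- a) ^ n) has_sum ?s) {1..}"
    by (rule has_sum_geometric_from_1) (use assms in simp)
  then have g: "((\<lambda>n. exp (- a * real n)) has_sum ?s) {1..}"
    by (simp add: exp_of_nat_mult[symmetric] mult.commute)
  have "(?f has_sum ?s) {1..}"
    using g by (subst (asm) has_sum_reindex_bij_witness[of "{1::int..}" int nat, symmetric]) auto
  moreover have "(?f has_sum ?s) {..-1}"
    using g by (subst (asm) has_sum_reindex_bij_witness[of "{..-1::int}" "\<lambda>n. - int n" "\<lambda>k. nat (- k)", symmetric]) auto
  ultimately have "(?f has_sum ?s + ?s) ({1..} \<union> {..-1})"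
    by (intro has_sum_Un_disjoint) auto
  moreover have "{1..} \<union> {..-1} = - {0::int}"
    by auto
  ultimately show ?thesis by (simp add: mult_2[symmetric])
qed

lemma summable_on_exp_abs_int:
  fixes a :: real
  assumes "a > 0"
  shows "(\<lambda>k::int. exp (- a * \<bar>of_int k\<bar>)) summable_on UNIV"
proof -
  have "(\<lambda>k::int. exp (- a * \<bar>of_int k\<bar>)) summable_on (- {0}) \<union> {0}"
    using has_sum_imp_summable[OF has_sum_geometric_int_nonzero[OF assms]]
    by (intro summable_on_Un_disjoint) auto
  moreover have "(- {0}) \<union> {0} = (UNIV :: int set)"
    by auto
  ultimately show ?thesis by simp
qed

lemma summable_on_exp_bound_int:
  fixes f :: "int \<Rightarrow> 'a :: banach" and a C :: real
  assumes "a > 0" "\<And>k. norm (f k) \<le> C * exp (- a * \<bar>of_int k\<bar>)"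
  shows "f summable_on UNIV"
proof (rule abs_summable_summable, rule Infinite_Sum.abs_summable_on_comparison_test')
  show "(\<lambda>k::int. C * exp (- a * \<bar>of_int k\<bar>)) summable_on UNIV"
    by (intro summable_on_cmult_right summable_on_exp_abs_int assms)
qed (rule assms(2))

lemma abs_of_int_le_square: "\<bar>of_int k :: real\<bar> \<le> (of_int k)\<^sup>2"
proof -
  have "\<bar>k\<bar> * 1 \<le> \<bar>k\<bar> * \<bar>k\<bar>"
    by (cases "k = 0") (simp, intro mult_left_mono, auto)
  then have "\<bar>k\<bar> \<le> k\<^sup>2"
    by (simp add: power2_eq_square)
  then have "real_of_int \<bar>k\<bar> \<le> real_of_int (k\<^sup>2)"
    by (simp only: of_int_le_iff)
  then show ?thesis by simp
qed

lemma exp_square_int_le: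
  fixes a :: real
  assumes "a > 0"
  shows "exp (- a * (of_int k)\<^sup>2) \<le> exp (- a * \<bar>of_int k\<bar>)"
  using assms abs_of_int_le_square[of k] by simp

section \<open>The theta function\<close>

text \<open>Jacobi's fourth theta function with nome \<open>exp (- a)\<close> at
  \<open>pi * \<nu>\<close>. The cosine form makes it real, so that its sign can be
  discussed.\<close>

definition theta :: "real \<Rightarrow> real \<Rightarrow> real" where
  "theta a \<nu> = (\<Sum>\<^sub>\<infinity>k::int. (-1) powi k * exp (- a * (of_int k)\<^sup>2) * cos (2 * pi * of_int k * \<nu>))"

definition theta_term :: "real \<Rightarrow> real \<Rightarrow> int \<Rightarrow> complex" where
  "theta_term a \<nu> k = of_real ((-1) powi k * exp (- a * (of_int k)\<^sup>2)) * cis (2 * pi * of_int k * \<nu>)"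

lemma abs_minus_one_powi [simp]: "\<bar>(-1) powi k :: real\<bar> = 1"
  by (simp add: power_int_abs)

lemma norm_theta_summand_le:
  assumes "a > 0"
  shows "norm ((-1) powi k * exp (- a * (of_int k)\<^sup>2) * cos (2 * pi * of_int k * \<nu>)) \<le> exp (- a * \<bar>of_int k\<bar>)"
proof -
  have "exp (- a * (of_int k)\<^sup>2) * \<bar>cos (2 * pi * of_int k * \<nu>)\<bar> \<le> exp (- a * (of_int k)\<^sup>2) * 1"
    by (intro mult_left_mono) auto
  also have "\<dots> \<le> exp (- a * \<bar>of_int k\<bar>)"
    using exp_square_int_le[OF assms] by simp
  finally show ?thesis
    by (simp add: abs_mult)
qed

lemma norm_theta_term: "norm (theta_term a \<nu> k) = exp (- a * (of_int k)\<^sup>2)"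
  unfolding theta_term_def rcis_def[symmetric] by (simp add: abs_mult)

lemma summable_theta_term:
  assumes "a > 0"
  shows "theta_term a \<nu> summable_on UNIV"
  by (rule summable_on_exp_bound_int[of a _ 1])
    (use assms exp_square_int_le in \<open>simp_all add: norm_theta_term\<close>)

text \<open>The weights are even in \<open>k\<close> and the sines odd, so the imaginary part
  cancels.\<close>

lemma infsum_theta_term:
  assumes "a > 0"
  shows "infsum (theta_term a \<nu>) UNIV = of_real (theta a \<nu>)"
proof (rule complex_eqI)
  note s = summable_theta_term[OF assms, of \<nu>]
  show "Re (infsum (theta_term a \<nu>) UNIV) = Re (of_real (theta a \<nu>))"
    by (subst infsum_Re[OF s, symmetric]) (unfold theta_def theta_term_def rcis_def[symmetric], simp)
  have "(\<Sum>\<^sub>\<infinity>k. Im (theta_term a \<nu> k)) = 0"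
    by (rule infsum_antisymmetric[of _ uminus])
      (unfold theta_term_def rcis_def[symmetric], auto simp: power_int_minus_one_minus)
  then show "Im (infsum (theta_term a \<nu>) UNIV) = Im (of_real (theta a \<nu>))"
    by (subst infsum_Im[OF s, symmetric]) simp
qed

lemma continuous_theta:
  assumes "a > 0"
  shows "continuous_on UNIV (theta a)"
proof -
  have "uniform_limit UNIV
      (\<lambda>X \<nu>. \<Sum>k\<in>X. (-1) powi k * exp (- a * (of_int k)\<^sup>2) * cos (2 * pi * of_int k * \<nu>))
      (theta a) (finite_subsets_at_top UNIV)"
    unfolding theta_def
    by (rule Weierstrass_m_test_general) (rule norm_theta_summand_le summable_on_exp_abs_int, rule assms)+
  then show ?thesis
    by (rule uniform_limit_theorem[rotated])
      (auto intro!: always_eventually continuous_intros)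
qed

section \<open>Positivity of the theta function\<close>

text \<open>The term at 0 is 1; the others add up to at most \<open>2 / (exp a - 1)\<close> in
  absolute value, which is below 1 once \<open>exp a > 3\<close>.\<close>

lemma theta_pos_of_large:
  assumes "a \<ge> 2"
  shows "theta a \<nu> > 0"
proof -
  have a: "a > 0" using assms by simp
  define f where "f k = (-1) powi k * exp (- a * (of_int k)\<^sup>2) * cos (2 * pi * of_int k * \<nu>)" for k :: int
  have bound: "norm (f k) \<le> exp (- a * \<bar>of_int k\<bar>)" for k
    unfolding f_def by (rule norm_theta_summand_le[OF a])
  have "f summable_on UNIV"
    by (rule summable_on_exp_bound_int[of a _ 1]) (use a bound in auto)
  then have sf: "f summable_on - {0}"
    by (rule summable_on_subset_banach) auto
  have "theta a \<nu> = infsum f UNIV"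
    by (simp only: theta_def f_def[abs_def])
  also have "\<dots> = infsum f ({0} \<union> - {0})"
    by simp
  also have "\<dots> = f 0 + infsum f (- {0})"
    by (subst infsum_Un_disjoint) (use sf in auto)
  finally have theta: "theta a \<nu> = 1 + infsum f (- {0})"
    by (simp add: f_def)
  have "norm (infsum f (- {0})) \<le> 2 * (exp (- a) / (1 - exp (- a)))"
    by (rule norm_infsum_le[OF has_sum_infsum[OF sf] has_sum_geometric_int_nonzero[OF a]])
      (rule bound)
  also have "\<dots> < 1"
  proof -
    \<comment> \<open>The Taylor bound \<open>1 + a + a\<^sup>2 / 2\<close> is at least 5 for
      \<open>a \<ge> 2\<close>.\<close>
    have "exp a > 3"
      using exp_lower_Taylor_quadratic[of a] assms power_mono[of 2 a 2] by simp
    moreover have "2 * (exp (- a) / (1 - exp (- a))) = 2 / (exp a - 1)"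
      using a by (simp add: exp_minus field_simps)
    ultimately show ?thesis
      using a by simp
  qed
  finally show ?thesis
    using theta by simp
qed

text \<open>Expand the product over pairs \<open>(m, n)\<close>. The shift by 1/2 removes the signs
  from the second factor, so pairs of odd sum cancel under swapping. The others are
  \<open>m = b + c\<close>, \<open>n = b - c\<close>, and
  \<open>m\<^sup>2 + n\<^sup>2 = 2 * (b\<^sup>2 + c\<^sup>2)\<close> doubles the parameter.\<close>

lemma theta_landen:
  assumes a: "a > 0"
  shows "theta a x * theta a (x + 1/2) = theta (2 * a) 0 * theta (2 * a) (2 * x)"
proof -
  let ?F = "\<lambda>(m, n). theta_term a x m * theta_term a (x + 1/2) n"
  define E where "E = {(m, n). even (m + n :: int)}"
  have shift: "theta_term a (x + 1/2) n = of_real (exp (- a * (of_int n)\<^sup>2)) * cis (2 * pi * of_int n * x)" for n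
  proof -
    have "cis (2 * pi * of_int n * (x + 1/2)) = cis (2 * pi * of_int n * x) * cis (pi * of_int n)"
      by (simp add: cis_mult algebra_simps)
    moreover have "cis (pi * of_int n) = of_real ((-1) powi n)"
      using cis_power_int[of pi n] by (simp add: mult.commute)
    ultimately show ?thesis
      by (cases "even n") (simp_all add: theta_term_def power_int_minus_left)
  qed
  have s: "?F summable_on UNIV"
    using summable_on_times_complex[OF summable_theta_term[OF a] summable_theta_term[OF a]] by simp
  have "infsum ?F UNIV = infsum ?F (E \<union> - E)"
    by simp
  also have "\<dots> = infsum ?F E + infsum ?F (- E)"
    by (rule infsum_Un_disjoint) (auto intro: summable_on_subset_banach[OF s])
  also have "infsum ?F (- E) = 0"
  proof (rule infsum_antisymmetric[of _ prod.swap])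
    fix z assume "z \<in> - E"
    then obtain m n where z: "z = (m, n)" "odd (m + n)"
      by (auto simp: E_def)
    then have "(-1 :: real) powi n = - ((-1) powi m)"
      by (auto simp: power_int_minus_left)
    then show "?F (prod.swap z) = - ?F z"
      by (simp only: z swap_simp prod.case shift) (simp add: theta_term_def mult_ac)
  qed (auto simp: E_def add.commute)
  also have "infsum ?F E = infsum (\<lambda>(b, c). theta_term (2 * a) (2 * x) b * theta_term (2 * a) 0 c) (UNIV \<times> UNIV)"
  proof (rule infsum_reindex_bij_witness[of _ "\<lambda>(b, c). (b + c, b - c)" "\<lambda>(m, n). ((m + n) div 2, (m - n) div 2)"])
    fix z assume "z \<in> E"
    then obtain m n where z: "z = (m, n)" "even (m + n)"
      by (auto simp: E_def)
    \<comment> \<open>Both halves are exact, since \<open>m + n\<close> and \<open>m - n\<close> are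
      even on \<open>E\<close>.\<close>
    define b c where "b = (m + n) div 2" and "c = (m - n) div 2"
    have mn: "m = b + c" "n = b - c"
      unfolding b_def c_def using z(2) by presburger+
    have "complex_of_real (exp (- a * (of_int m)\<^sup>2)) * of_real (exp (- a * (of_int n)\<^sup>2))
        = of_real (exp (- (2 * a) * (of_int b)\<^sup>2)) * of_real (exp (- (2 * a) * (of_int c)\<^sup>2))"
      by (simp add: mn of_real_mult[symmetric] del: of_real_mult add: exp_add[symmetric] power2_eq_square algebra_simps)
    moreover have "cis (2 * pi * of_int m * x) * cis (2 * pi * of_int n * x) = cis (2 * pi * of_int b * (2 * x))"
      by (simp add: mn cis_mult algebra_simps)
    moreover have "complex_of_real ((-1) powi m) = of_real ((-1) powi b) * of_real ((-1) powi c)"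
      by (simp add: mn power_int_add)
    moreover have "cis (2 * pi * of_int c * 0) = 1"
      by simp
    ultimately show "(case case z of (m, n) \<Rightarrow> ((m + n) div 2, (m - n) div 2) of
        (b, c) \<Rightarrow> theta_term (2 * a) (2 * x) b * theta_term (2 * a) 0 c) = ?F z"
      unfolding z(1) prod.case b_def[symmetric] c_def[symmetric] shift
      unfolding theta_term_def of_real_mult
      by algebra
  qed ((auto simp: E_def; presburger)+)
  also have "\<dots> = of_real (theta (2 * a) (2 * x) * theta (2 * a) 0)"
    using infsum_times_complex[OF summable_theta_term summable_theta_term, of "2 * a" "2 * a" "2 * x" 0] a
    by (simp add: infsum_theta_term)
  finally have "infsum ?F UNIV = of_real (theta (2 * a) (2 * x) * theta (2 * a) 0)"
    by simp
  moreover have "infsum ?F UNIV = of_real (theta a x * theta a (x + 1/2))"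
    using infsum_times_complex[OF summable_theta_term[OF a] summable_theta_term[OF a], of x "x + 1/2"]
    by (simp add: infsum_theta_term[OF a])
  ultimately show ?thesis
    by (metis mult.commute of_real_eq_iff)
qed

text \<open>At 1/2 the cosine is \<open>(-1) powi k\<close> and cancels the sign, leaving positive
  terms.\<close>

lemma theta_half_pos:
  assumes a: "a > 0"
  shows "theta a (1/2) > 0"
proof -
  have eq: "(-1) powi k * exp (- a * (of_int k)\<^sup>2) * cos (2 * pi * of_int k * (1/2)) = exp (- a * (of_int k)\<^sup>2)" for k :: int
  proof -
    have "cos (pi * of_int k) = (-1) powi k"
      by (simp add: power_int_minus_left)
    then show ?thesis by simp
  qed
  show ?thesis
    unfolding theta_def eq
    by (rule infsum_pos_real, rule summable_on_exp_bound_int[of a _ 1])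
      (use a exp_square_int_le in auto)
qed

text \<open>A nonpositive value and the positive one at 1/2 would force a zero of
  \<open>theta a\<close> by continuity, and Landen's identity would pass it on to a product of
  positive values.\<close>

lemma theta_pos_of_double:
  assumes a: "a > 0" and pos: "\<And>\<nu>. theta (2 * a) \<nu> > 0"
  shows "theta a \<nu> > 0"
proof (rule ccontr)
  assume "\<not> theta a \<nu> > 0"
  have conn: "connected (range (theta a))"
    by (rule connected_continuous_image[OF continuous_theta[OF a]]) auto
  have "0 \<in> range (theta a)"
    using connectedD_interval[OF conn, of "theta a \<nu>" "theta a (1/2)" 0] theta_half_pos[OF a] \<open>\<not> theta a \<nu> > 0\<close> 
    by auto
  then obtain x where "theta a x = 0"
    by auto
  then have "theta (2 * a) 0 * theta (2 * a) (2 * x) = 0"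
    using theta_landen[OF a, of x] by simp
  with pos[of 0] pos[of "2 * x"] show False
    by simp
qed

lemma theta_pos:
  assumes "a > 0"
  shows "theta a \<nu> > 0"
proof -
  \<comment> \<open>After \<open>n\<close> doublings the parameter is in the range of
    \<open>theta_pos_of_large\<close>.\<close>
  obtain n where "2 / a < 2 ^ n"
    using real_arch_pow[of 2 "2 / a"] by auto
  then have "2 ^ n * a \<ge> 2"
    using assms by (simp add: field_simps)
  with assms show ?thesis
  proof (induction n arbitrary: a \<nu>)
    case 0
    then show ?case by (intro theta_pos_of_large) simp
  next
    case (Suc n)
    show ?case
      by (rule theta_pos_of_double) (use Suc in \<open>auto simp: mult_ac\<close>)
  qed
qed

section \<open>The Zak transforms of the two windows\<close>

text \<open>From \<open>cosh y \<ge> exp \<bar>y\<bar> / 2\<close> and the triangle inequality for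
  \<open>t + of_int k\<close>.\<close>

lemma inverse_cosh_le:
  fixes a t :: real and k :: int
  assumes "a > 0"
  shows "1 / cosh (a * (t + of_int k)) \<le> (2 * exp (a * \<bar>t\<bar>)) * exp (- a * \<bar>of_int k\<bar>)"
proof -
  let ?x = "a * (t + of_int k)"
  have "cosh ?x = cosh \<bar>?x\<bar>"
    by simp
  also have "\<dots> \<ge> exp \<bar>?x\<bar> / 2"
    by (simp add: cosh_def)
  finally have "1 / cosh ?x \<le> 1 / (exp \<bar>?x\<bar> / 2)"
    by (intro divide_left_mono) auto
  also have "\<dots> = 2 * exp (- \<bar>?x\<bar>)"
    by (simp add: exp_minus field_simps)
  also have "- \<bar>?x\<bar> \<le> a * \<bar>t\<bar> - a * \<bar>of_int k\<bar>"
  proof -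
    have "a * (\<bar>of_int k\<bar> - \<bar>t\<bar>) \<le> a * \<bar>t + of_int k\<bar>"
      using assms by (intro mult_left_mono) auto
    then show ?thesis
      using assms by (simp add: abs_mult right_diff_distrib)
  qed
  then have "2 * exp (- \<bar>?x\<bar>) \<le> 2 * exp (a * \<bar>t\<bar> - a * \<bar>of_int k\<bar>)"
    by simp
  also have "\<dots> = (2 * exp (a * \<bar>t\<bar>)) * exp (- a * \<bar>of_int k\<bar>)"
    by (simp add: exp_diff exp_minus field_simps)
  finally show ?thesis .
qed

lemma summable_sech:
  fixes a t :: real
  assumes "a > 0"
  shows "(\<lambda>l::int. 1 / cosh (a * (t - of_int l))) summable_on UNIV"
  by (rule summable_on_exp_bound_int[of a _ "2 * exp (a * \<bar>t\<bar>)"])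
    (use assms inverse_cosh_le[OF assms, of t "- l" for l] in auto)

lemma summable_gaussian:
  fixes a t :: real
  assumes "a > 0"
  shows "(\<lambda>l::int. exp (- a * (t - of_int l)\<^sup>2)) summable_on UNIV"
proof (rule summable_on_exp_bound_int[of a _ "exp (a * (\<bar>t\<bar> + 1))"])
  fix l :: int
  let ?x = "\<bar>t - of_int l\<bar>"
  \<comment> \<open>Gives a linear lower bound for the square, hence geometric decay in
    \<open>l\<close>; its offset 1 is the one in the constant
    \<open>exp (a * (\<bar>t\<bar> + 1))\<close>.\<close>
  have "(?x - 1)\<^sup>2 + ?x \<ge> 0"
    by simp
  then have "?x - 1 \<le> ?x\<^sup>2"
    by (simp add: power2_eq_square algebra_simps del: abs_mult_self_eq)
  then have "\<bar>of_int l\<bar> - (\<bar>t\<bar> + 1) \<le> (t - of_int l)\<^sup>2"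
    by (simp only: power2_abs)
  then have "a * (\<bar>of_int l\<bar> - (\<bar>t\<bar> + 1)) \<le> a * (t - of_int l)\<^sup>2"
    using assms by (intro mult_left_mono) auto
  then have "- a * (t - of_int l)\<^sup>2 \<le> a * (\<bar>t\<bar> + 1) + - a * \<bar>of_int l\<bar>"
    by (simp add: algebra_simps)
  then show "norm (exp (- a * (t - of_int l)\<^sup>2)) \<le> exp (a * (\<bar>t\<bar> + 1)) * exp (- a * \<bar>of_int l\<bar>)"
    by (simp only: exp_add[symmetric] norm_exp exp_le_cancel_iff real_norm_def abs_exp_cancel)
qed (rule assms)

section \<open>Quasi-periodicity of the Fourier coefficients\<close>

text \<open>The function \<open>h\<close> of the introduction: its value at
  \<open>t - of_int n\<close> is the \<open>n\<close>-th Fourier coefficient of the product of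
  \<open>theta a\<close> and \<open>sech_zak a t\<close>.\<close>

definition sech_theta :: "real \<Rightarrow> real \<Rightarrow> real" where
  "sech_theta a s = (\<Sum>\<^sub>\<infinity>k::int. (-1) powi k * exp (- a * (of_int k)\<^sup>2) / cosh (a * (s + of_int k)))"

lemma summable_sech_theta:
  fixes a s :: real
  assumes "a > 0"
  shows "(\<lambda>k::int. (-1) powi k * exp (- a * (of_int k)\<^sup>2) / cosh (a * (s + of_int k))) summable_on UNIV"
proof (rule summable_on_exp_bound_int[of a _ 1])
  fix k :: int
  have "exp (- a * (of_int k)\<^sup>2) / cosh (a * (s + of_int k)) \<le> exp (- a * (of_int k)\<^sup>2) / 1"
    by (intro divide_left_mono) (auto simp: cosh_real_ge_1)
  also have "\<dots> \<le> exp (- a * \<bar>of_int k\<bar>)"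
    using exp_square_int_le[OF assms] by simp
  finally show "norm ((-1) powi k * exp (- a * (of_int k)\<^sup>2) / cosh (a * (s + of_int k))) \<le> 1 * exp (- a * \<bar>of_int k\<bar>)"
    by (simp add: abs_mult)
qed (rule assms)

text \<open>This is the functional equation satisfied by the Gaussian
  \<open>exp (- a * t\<^sup>2)\<close>, so dividing by the Gaussian gives period 1.\<close>

lemma sech_theta_add_one:
  fixes a t :: real
  assumes a: "a > 0"
  shows "sech_theta a (t + 1) * exp (a * (2 * t + 1)) = sech_theta a t"
proof -
  let ?u = "\<lambda>k::int. (-1) powi k * exp (- a * (of_int k)\<^sup>2) / cosh (a * (t + of_int k))"
  let ?v = "\<lambda>k::int. (-1) powi k * exp (- a * (of_int k)\<^sup>2) / cosh (a * ((t + 1) + of_int k)) * exp (a * (2 * t + 1))"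
  let ?w = "\<lambda>k::int. - (?u k * exp (2 * (a * (t + of_int k))))"
  \<comment> \<open>Here \<open>?w k\<close> is \<open>?v (k - 1)\<close>; the shift gives
    \<open>?u\<close> and \<open>?w\<close> the same denominator.\<close>
  have reindex: "(?v has_sum S) UNIV \<longleftrightarrow> (?w has_sum S) UNIV" for S
  proof (rule has_sum_reindex_bij_witness[of _ "\<lambda>k. k - 1" "\<lambda>k. k + 1"])
    fix k :: int
    have "exp (- a * (of_int (k + 1))\<^sup>2) * exp (2 * (a * (t + of_int (k + 1))))
        = exp (- a * (of_int k)\<^sup>2) * exp (a * (2 * t + 1))"
      by (simp add: exp_add[symmetric] power2_eq_square algebra_simps)
    moreover have "(-1 :: real) powi (k + 1) = - ((-1) powi k)"
      by (simp add: power_int_add)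
    moreover have "t + of_int (k + 1) = (t + 1) + real_of_int k"
      by simp
    ultimately show "?w (k + 1) = ?v k"
      by (simp only:) (simp add: field_simps)
  qed auto
  have v: "(?v has_sum sech_theta a (t + 1) * exp (a * (2 * t + 1))) UNIV"
    unfolding sech_theta_def
    by (intro has_sum_cmult_left has_sum_infsum summable_sech_theta a)
  then have w: "(?w has_sum sech_theta a (t + 1) * exp (a * (2 * t + 1))) UNIV"
    by (simp only: reindex)
  have u: "(?u has_sum sech_theta a t) UNIV"
    unfolding sech_theta_def by (intro has_sum_infsum summable_sech_theta a)
  have "(\<Sum>\<^sub>\<infinity>k. ?u k - ?w k) = sech_theta a t - sech_theta a (t + 1) * exp (a * (2 * t + 1))"
    using infsumI[OF has_sum_add[OF u has_sum_uminusI[OF w]]] by simp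
  moreover have "(\<Sum>\<^sub>\<infinity>k. ?u k - ?w k) = 0"
  \<comment> \<open>The reflection preserves \<open>k * (1 - k)\<close>, to which the exponent
    reduces up to the factor \<open>a\<close> and the summand \<open>a * t\<close>, and flips the
    sign \<open>(-1) powi k\<close>.\<close>
  proof (rule infsum_antisymmetric[of _ "\<lambda>k. 1 - k"])
    have *: "?u k - ?w k = (-1) powi k * (2 * exp (- a * (of_int k)\<^sup>2 + a * (t + of_int k)))" for k :: int
    proof -
      \<comment> \<open>This removes the hyperbolic cosine from the denominator.\<close>
      have "1 + exp (2 * x) = 2 * exp x * cosh x" for x :: real
        by (simp add: cosh_field_def distrib_left mult.assoc exp_add[symmetric])
      then have "(1 + exp (2 * x)) / cosh x = 2 * exp x" for x :: real
        by simp
      moreover have "p / c - - (p / c * e) = p * ((1 + e) / c)" for p c e :: real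
        by (simp add: add_divide_distrib distrib_left)
      ultimately have "?u k - ?w k = (-1) powi k * exp (- a * (of_int k)\<^sup>2) * (2 * exp (a * (t + of_int k)))"
        by (simp only:)
      then show ?thesis
        by (simp only: exp_add mult_ac)
    qed
    fix k :: int
    have "(-1 :: real) powi (1 - k) = - ((-1) powi k)"
      by (simp add: power_int_minus_left)
    moreover have "- a * (of_int (1 - k))\<^sup>2 + a * (t + of_int (1 - k)) = - a * (of_int k)\<^sup>2 + a * (t + of_int k)"
      by (simp add: power2_eq_square algebra_simps)
    ultimately show "?u (1 - k) - ?w (1 - k) = - (?u k - ?w k)"
      unfolding * by simp
  qed auto
  ultimately show ?thesis by simp
qed

definition zak_ratio :: "real \<Rightarrow> real \<Rightarrow> real" where
  "zak_ratio a t = sech_theta a t * exp (a * t\<^sup>2)"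

lemma zak_ratio_add_one:
  assumes "a > 0"
  shows "zak_ratio a (t + 1) = zak_ratio a t"
proof -
  have "exp (a * (t + 1)\<^sup>2) = exp (a * (2 * t + 1)) * exp (a * t\<^sup>2)"
    by (simp add: exp_add[symmetric] power2_eq_square algebra_simps)
  then show ?thesis
    using sech_theta_add_one[OF assms, of t] by (simp add: zak_ratio_def)
qed

lemma zak_ratio_diff_int:
  assumes "a > 0"
  shows "zak_ratio a (t - of_int n) = zak_ratio a t"
proof (induction n rule: int_induct[of _ 0])
  case (step1 i)
  then show ?case
    using zak_ratio_add_one[OF assms, of "t - of_int (i + 1)"] by simp
next
  case (step2 i)
  then show ?case
    using zak_ratio_add_one[OF assms, of "t - of_int i"] by (simp add: algebra_simps)
qed simp

text \<open>By periodicity all Fourier coefficients share one factor, and what remains are the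
  Gaussian samples.\<close>

lemma sech_theta_diff_int:
  assumes "a > 0"
  shows "sech_theta a (t - of_int n) = zak_ratio a t * exp (- a * (t - of_int n)\<^sup>2)"
  using zak_ratio_diff_int[OF assms, of t n] by (simp add: zak_ratio_def exp_minus field_simps)

section \<open>Factorisation relating the two Zak transforms\<close>

text \<open>The positive normalising constant of the window is dropped, as it does not affect the
  phase.\<close>

definition sech_zak :: "real \<Rightarrow> real \<Rightarrow> real \<Rightarrow> complex" where
  "sech_zak a t \<nu> = (\<Sum>\<^sub>\<infinity>l::int. of_real (1 / cosh (a * (t - of_int l))) * cis (2 * pi * of_int l * \<nu>))"

definition gaussian_zak :: "real \<Rightarrow> real \<Rightarrow> real \<Rightarrow> complex" where
  "gaussian_zak a t \<nu> = (\<Sum>\<^sub>\<infinity>l::int. of_real (exp (- a * (t - of_int l)\<^sup>2)) * cis (2 * pi * of_int l * \<nu>))"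

lemma theta_sech_zak:
  assumes a: "a > 0"
  shows "of_real (theta a \<nu>) * sech_zak a t \<nu> = of_real (zak_ratio a t) * gaussian_zak a t \<nu>"
proof -
  let ?g = "\<lambda>l::int. of_real (1 / cosh (a * (t - of_int l))) * cis (2 * pi * of_int l * \<nu>)"
  have g: "?g summable_on UNIV"
    by (rule abs_summable_summable) (use summable_sech[OF a, of t] in \<open>simp add: norm_mult norm_divide\<close>)
  have inner: "(\<Sum>\<^sub>\<infinity>k. theta_term a \<nu> k * ?g (n - k))
      = of_real (zak_ratio a t) * (of_real (exp (- a * (t - of_int n)\<^sup>2)) * cis (2 * pi * of_int n * \<nu>))" for n
  proof -
    let ?u = "\<lambda>k::int. (-1) powi k * exp (- a * (of_int k)\<^sup>2) / cosh (a * ((t - of_int n) + of_int k))"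
    have "theta_term a \<nu> k * ?g (n - k) = of_real (?u k) * cis (2 * pi * of_int n * \<nu>)" for k
    proof -
      \<comment> \<open>The phases combine to one independent of \<open>k\<close>, so the inner sum
        is \<open>sech_theta\<close> at \<open>t - of_int n\<close>.\<close>
      have "cis (2 * pi * of_int k * \<nu>) * cis (2 * pi * of_int (n - k) * \<nu>) = cis (2 * pi * of_int n * \<nu>)"
        by (simp add: cis_mult algebra_simps)
      moreover have "t - of_int (n - k) = (t - of_int n) + real_of_int k"
        by simp
      ultimately show ?thesis
        unfolding theta_term_def by (simp only: of_real_mult of_real_divide flip: mult.assoc) (simp add: field_simps)
    qed
    then have "(\<Sum>\<^sub>\<infinity>k. theta_term a \<nu> k * ?g (n - k)) = (\<Sum>\<^sub>\<infinity>k. of_real (?u k) * cis (2 * pi * of_int n * \<nu>))"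
      by simp
    also have "\<dots> = of_real (sech_theta a (t - of_int n)) * cis (2 * pi * of_int n * \<nu>)"
      unfolding sech_theta_def
      by (intro infsumI has_sum_cmult_left has_sum_of_real has_sum_infsum summable_sech_theta a)
    finally show ?thesis
      by (simp add: sech_theta_diff_int[OF a])
  qed
  have "of_real (theta a \<nu>) * sech_zak a t \<nu> = (\<Sum>\<^sub>\<infinity>n. \<Sum>\<^sub>\<infinity>k. theta_term a \<nu> k * ?g (n - k))"
    unfolding sech_zak_def infsum_theta_term[OF a, symmetric]
    by (rule infsum_convolution_int[OF summable_theta_term[OF a] g])
  also have "\<dots> = of_real (zak_ratio a t) * gaussian_zak a t \<nu>"
    unfolding inner gaussian_zak_def by (rule infsum_cmult_right')
  finally show ?thesis .
qed

text \<open>At \<open>\<nu> = 0\<close> all exponentials are 1 and both Zak transforms are sums of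
  positive terms, so the sign comes from \<open>theta a 0\<close>.\<close>

lemma zak_ratio_pos:
  assumes a: "a > 0"
  shows "zak_ratio a t > 0"
proof -
  let ?G = "\<Sum>\<^sub>\<infinity>l::int. 1 / cosh (a * (t - of_int l))" and ?F = "\<Sum>\<^sub>\<infinity>l::int. exp (- a * (t - of_int l)\<^sup>2)"
  have "sech_zak a t 0 = of_real ?G"
    unfolding sech_zak_def
    using infsumI[OF has_sum_of_real[OF has_sum_infsum[OF summable_sech[OF a, of t]], where 'a = complex]]
    by simp
  moreover have "gaussian_zak a t 0 = of_real ?F"
    unfolding gaussian_zak_def
    using infsumI[OF has_sum_of_real[OF has_sum_infsum[OF summable_gaussian[OF a, of t]], where 'a = complex]]
    by simp
  ultimately have "complex_of_real (theta a 0 * ?G) = of_real (zak_ratio a t * ?F)"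
    using theta_sech_zak[OF a, of 0 t] by simp
  then have eq: "theta a 0 * ?G = zak_ratio a t * ?F"
    by (simp only: of_real_eq_iff)
  have "?G > 0" "?F > 0"
    by (rule infsum_pos_real; use summable_sech[OF a] summable_gaussian[OF a] in simp)+
  with eq theta_pos[OF a, of 0] show ?thesis
    by (metis mult_pos_pos zero_less_mult_pos2)
qed

section \<open>Equality of phases and of the tight windows\<close>

lemma zak_gaussian_window:
  "zak (gaussian_window \<gamma>) t \<nu> = of_real ((2 * \<gamma>) powr (1/4)) * gaussian_zak (pi * \<gamma>) t \<nu>"
  unfolding zak_def gaussian_zak_def gaussian_window_def
  by (subst infsum_cmult_right'[symmetric]) (simp add: cis_conv_exp mult_ac)

lemma zak_sech_window:
  "zak (sech_window \<gamma>) t \<nu> = of_real ((pi * \<gamma> / 2) powr (1/2)) * sech_zak (pi * \<gamma>) t \<nu>"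
  unfolding zak_def sech_zak_def sech_window_def
  by (subst infsum_cmult_right'[symmetric]) (simp add: cis_conv_exp mult_ac)

theorem mainTheorem3:
  fixes \<gamma> :: real
  assumes "\<gamma> > 0"
  shows "tight_window (gaussian_window \<gamma>) = tight_window (sech_window \<gamma>)"
proof -
  let ?a = "pi * \<gamma>"
  have a: "?a > 0"
    using assms by simp
  have "zak (gaussian_window \<gamma>) t \<nu> / of_real (cmod (zak (gaussian_window \<gamma>) t \<nu>))
      = zak (sech_window \<gamma>) t \<nu> / of_real (cmod (zak (sech_window \<gamma>) t \<nu>))" for t \<nu>
  proof -
    \<comment> \<open>A positive factor leaves the phase unchanged; for \<open>z = 0\<close> both
      quotients are 0, so the integrands agree at every \<open>\<nu>\<close>.\<close>
    have pos: "of_real r * z / of_real (cmod (of_real r * z)) = z / of_real (cmod z)" if "r > 0" for r z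
      using that by (simp add: norm_mult)
    \<comment> \<open>Both phases equal that of the common product in
      \<open>theta_sech_zak\<close>.\<close>
    have "gaussian_zak ?a t \<nu> / of_real (cmod (gaussian_zak ?a t \<nu>))
        = sech_zak ?a t \<nu> / of_real (cmod (sech_zak ?a t \<nu>))"
      using pos[OF theta_pos[OF a, of \<nu>], of "sech_zak ?a t \<nu>"]
        pos[OF zak_ratio_pos[OF a, of t], of "gaussian_zak ?a t \<nu>"]
      by (simp only: theta_sech_zak[OF a])
    then show ?thesis
      using assms by (simp add: zak_gaussian_window zak_sech_window pos)
  qed
  then show ?thesis
    by (simp add: tight_window_def fun_eq_iff)
qed

end
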